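(* For every integer $n\ge1$, the expectation of the number $X_n$ of swaps of Quicksort for a list of length $n$ under Variant I is $$E[X_n]=(n+1)H_1(n)-2n.$$
   Context: $H_k(n)=\sum_{i=1}^n \frac1{i^k}$. Variant I of Quicksort, applied to a uniformly random ordering of $n$ distinct elements: the first element of the list is the pivot; every other element is compared with the pivot and, if smaller than the pivot, it is removed and inserted before the pivot (this counts as one swap); then the procedure is applied recursively to the sublists of elements before and after the pivot. Thus partitioning costs $k-1$ swaps when the pivot is the $k$-th smallest element. $X_n$ is the total number of swaps. Formally, the probability generating function $P_n(t)=\sum_{m\ge0}P(X_n=m)t^m$ is determined by $P_0(t)=P_1(t)=1$ and $P_n(t)=\frac1n\sum_{k=1}^n P_{k-1}(t)P_{n-k}(t)\,t^{k-1}$ for $n\ge2$. *)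

theory Defs
  imports "HOL-Probability.Random_Permutations"
begin

definition H :: "nat \<Rightarrow> nat \<Rightarrow> real" where
  "H k n = (\<Sum>i = 1..n. 1 / real i ^ k)"

(* The number of swaps of Quicksort (Variant I) on a list. The pivot p is the head. Each other
   element x is compared with p, and each x < p is removed and reinserted directly before p, at the
   cost of one swap. Hence the list becomes filter (x < p) xs @ p # filter (not x < p) xs, both
   sublists keeping their relative order, and the procedure recurses into these two sublists. *)
fun quicksort_swaps :: "'a :: linorder list \<Rightarrow> nat" where
  "quicksort_swaps [] = 0"
| "quicksort_swaps (p # xs) =
     (let before = filter (\<lambda>x. x < p) xs;
          after = filter (\<lambda>x. \<not> x < p) xs
      in length before + quicksort_swaps before + quicksort_swaps after)"

(* The distribution of X_n, where n = card A: the input is a uniformly random ordering of A.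
   Only meaningful for finite A. *)
definition swaps_pmf :: "'a :: linorder set \<Rightarrow> nat pmf" where
  "swaps_pmf A = map_pmf quicksort_swaps (pmf_of_set (permutations_of_set A))"

end

theory Submission
  imports Defs
begin

text \<open>
  Condition on the pivot. If \<open>p\<close> is the first element of a uniformly random ordering of \<open>A\<close>, then
  \<open>p\<close> is uniform on \<open>A\<close>, and the two sublists formed by partitioning are again uniformly random
  orderings, of the elements of \<open>A\<close> below and above \<open>p\<close>. By linearity of expectation,
  the mean number of swaps for \<open>A\<close> is the average over \<open>p \<in> A\<close> of the number of elements
  below \<open>p\<close> plus the means for these two smaller sets
  (\<open>expectation_swaps_rec\<close>).

  Numbering each pivot by the count \<open>k\<close> of elements below it turns the sum over pivots into a sum over \<open>k = 0, \<dots>, n - 1\<close>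
  (\<open>bij_betw_card_less\<close>). By strong induction on \<open>n = card A\<close>, the theorem then amounts to
  the fact that \<open>f n = (n + 1) H\<^sub>1(n) - 2 n\<close> solves
  \<open>n f n = (\<Sum>k<n. k + f k + f (n - 1 - k))\<close>. By the reflection \<open>k \<mapsto> n - 1 - k\<close> the last two
  terms have equal sums, and the recurrence telescopes: subtracting consecutive instances leaves
  \<open>(n + 1) f (n + 1) = (n + 2) f n + n\<close>, which follows from \<open>H\<^sub>1(n + 1) = H\<^sub>1(n) + 1 / (n + 1)\<close>.
\<close>

definition mean_swaps :: "nat \<Rightarrow> real" where
  "mean_swaps n = (real n + 1) * H 1 n - 2 * real n"

lemma mean_swaps_Suc:
  "real (Suc n) * mean_swaps (Suc n) = real (n + 2) * mean_swaps n + real n"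
proof -
  have H: "H 1 (Suc n) = H 1 n + 1 / (real n + 1)"
    by (simp add: H_def add.commute)
  have cancel: "(real n + 1) * (1 / (real n + 1)) = 1"
    by simp
  have Suc: "real (Suc n) = real n + 1" "real (n + 2) = real n + 2"
    by simp_all
  show ?thesis
    unfolding mean_swaps_def H Suc using cancel by algebra
qed

lemma sum_mean_swaps:
  "2 * (\<Sum>k<n. mean_swaps k) = real n * mean_swaps n - real n * (real n - 1) / 2"
proof (induction n)
  case (Suc n)
  have "2 * (\<Sum>k<Suc n. mean_swaps k) =
      real (n + 2) * mean_swaps n - real n * (real n - 1) / 2"
    using Suc.IH by (simp add: algebra_simps)
  also have "\<dots> = real (Suc n) * mean_swaps (Suc n) - real n - real n * (real n - 1) / 2"
    unfolding mean_swaps_Suc by simp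
  also have "\<dots> = real (Suc n) * mean_swaps (Suc n) - real (Suc n) * (real (Suc n) - 1) / 2"
    by (simp add: diff_divide_distrib add_divide_distrib algebra_simps)
  finally show ?case .
qed simp

text \<open>
  The recurrence in the shape in which the pivot ranks produce it: a pivot with \<open>k\<close> smaller elements
  costs \<open>k\<close> swaps and leaves sublists of lengths \<open>k\<close> and \<open>n - 1 - k\<close>.
\<close>

lemma mean_swaps_rec:
  "(\<Sum>k<n. real k + mean_swaps k + mean_swaps (n - 1 - k)) = real n * mean_swaps n"
proof -
  have "(\<Sum>k<n. mean_swaps (n - 1 - k)) = (\<Sum>k<n. mean_swaps k)"
    using sum.nat_diff_reindex[of mean_swaps n] by simp
  moreover have "(\<Sum>k<n. real k) = real n * (real n - 1) / 2"
    by (induction n) (simp_all add: field_simps)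
  ultimately show ?thesis
    using sum_mean_swaps[of n] by (simp add: sum.distrib)
qed

lemma bij_betw_card_less:
  fixes A :: "'a :: linorder set"
  assumes "finite A"
  shows "bij_betw (\<lambda>p. card {x \<in> A. x < p}) A {..<card A}"
proof -
  have less: "card {x \<in> A. x < p} < card {x \<in> A. x < q}" if "p \<in> A" "p < q" for p q
  proof (rule psubset_card_mono)
    show "{x \<in> A. x < p} \<subset> {x \<in> A. x < q}"
      using that by (auto simp: psubset_eq intro: less_trans)
  qed (use assms in simp)
  have inj: "inj_on (\<lambda>p. card {x \<in> A. x < p}) A"
  proof (rule inj_onI)
    fix p q assume "p \<in> A" "q \<in> A" "card {x \<in> A. x < p} = card {x \<in> A. x < q}"
    then show "p = q"
      using less[of p q] less[of q p] by (cases p q rule: linorder_cases) simp_all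
  qed
  have "card {x \<in> A. x < p} < card A" if "p \<in> A" for p
    by (rule psubset_card_mono) (use assms that in auto)
  then have "(\<lambda>p. card {x \<in> A. x < p}) ` A \<subseteq> {..<card A}"
    by blast
  then have "(\<lambda>p. card {x \<in> A. x < p}) ` A = {..<card A}"
    by (rule card_subset_eq[rotated]) (simp_all add: card_image[OF inj])
  with inj show ?thesis
    unfolding bij_betw_def by (rule conjI)
qed

lemma card_greater:
  fixes A :: "'a :: linorder set"
  assumes "finite A" and "p \<in> A"
  shows "card {x \<in> A. p < x} = card A - 1 - card {x \<in> A. x < p}"
proof -
  have "card ({x \<in> A. x < p} \<union> {x \<in> A. p < x}) = card {x \<in> A. x < p} + card {x \<in> A. p < x}"
    using assms by (intro card_Un_disjoint) auto
  moreover have "{x \<in> A. x < p} \<union> {x \<in> A. p < x} = A - {p}"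
    by auto
  moreover have "card (A - {p}) = card A - 1"
    using assms by simp
  ultimately show ?thesis
    by simp
qed

text \<open>
  Partitioning a uniformly random ordering by a predicate yields uniformly random orderings of the
  two parts (\<open>partition_random_permutations\<close>), because every pair of orderings of the parts
  has the same number of interleavings. So linearity applies to the three summands of
  \<open>quicksort_swaps\<close> once the pivot \<open>p\<close> is given.
\<close>

lemma expectation_swaps_rec:
  fixes A :: "'a :: linorder set"
  assumes "finite A" and "A \<noteq> {}"
  shows "measure_pmf.expectation (swaps_pmf A) real =
    (\<Sum>p\<in>A. real (card {x \<in> A. x < p})
             + measure_pmf.expectation (swaps_pmf {x \<in> A. x < p}) real
             + measure_pmf.expectation (swaps_pmf {x \<in> A. p < x}) real) / real (card A)"
proof -
  let ?perm = "\<lambda>B :: 'a set. pmf_of_set (permutations_of_set B)"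
  let ?swaps = "\<lambda>xs :: 'a list. real (quicksort_swaps xs)"
  have expand: "measure_pmf.expectation (swaps_pmf B) real =
      measure_pmf.expectation (?perm B) ?swaps" for B :: "'a set"
    by (simp add: swaps_pmf_def)
  have pivot: "measure_pmf.expectation (map_pmf ((#) p) (?perm (A - {p}))) ?swaps =
      real (card {x \<in> A. x < p})
        + measure_pmf.expectation (swaps_pmf {x \<in> A. x < p}) real
        + measure_pmf.expectation (swaps_pmf {x \<in> A. p < x}) real"
    if "p \<in> A" for p
  proof -
    let ?L = "{x \<in> A. x < p}" and ?R = "{x \<in> A. p < x}"
    let ?M = "pair_pmf (?perm ?L) (?perm ?R)"
    have parts: "{x \<in> A - {p}. x < p} = ?L" "{x \<in> A - {p}. \<not> x < p} = ?R"
      by auto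
    have int: "integrable (measure_pmf ?M) g" for g :: "'a list \<times> 'a list \<Rightarrow> real"
      using \<open>finite A\<close> by (intro integrable_measure_pmf_finite) simp
    have len: "measure_pmf.expectation ?M (\<lambda>ys. real (length (fst ys))) = real (card ?L)"
    proof -
      have "measure_pmf.expectation ?M (\<lambda>ys. real (length (fst ys))) =
          measure_pmf.expectation ?M (\<lambda>_. real (card ?L))"
        using \<open>finite A\<close>
        by (intro integral_cong_AE)
           (auto simp: AE_measure_pmf_iff length_finite_permutations_of_set)
      then show ?thesis
        by simp
    qed
    have "measure_pmf.expectation (map_pmf ((#) p) (?perm (A - {p}))) ?swaps =
        measure_pmf.expectation (map_pmf (partition (\<lambda>x. x < p)) (?perm (A - {p})))
          (\<lambda>ys. real (length (fst ys)) + ?swaps (fst ys) + ?swaps (snd ys))"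
      by (simp add: Let_def o_def)
    also have "\<dots> = measure_pmf.expectation ?M
          (\<lambda>ys. real (length (fst ys)) + ?swaps (fst ys) + ?swaps (snd ys))"
      using \<open>finite A\<close> by (subst partition_random_permutations) (simp_all only: parts finite_Diff)
    also have "\<dots> = real (card ?L) + measure_pmf.expectation (?perm ?L) ?swaps
        + measure_pmf.expectation (?perm ?R) ?swaps"
      using expectation_pair_pmf_fst[of "?perm ?L" "?perm ?R" ?swaps]
        expectation_pair_pmf_snd[of "?perm ?L" "?perm ?R" ?swaps]
      by (simp add: int len)
    finally show ?thesis
      by (simp only: expand)
  qed
  have "?perm A = pmf_of_set A \<bind> (\<lambda>p. map_pmf ((#) p) (?perm (A - {p})))"
    using random_permutation_of_set[OF assms] by (simp add: map_pmf_def)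
  then have "measure_pmf.expectation (swaps_pmf A) real =
      (\<Sum>p\<in>A. measure_pmf.expectation (map_pmf ((#) p) (?perm (A - {p}))) ?swaps) / real (card A)"
    using assms unfolding expand
    by (simp add: pmf_expectation_bind_pmf_of_set divide_inverse sum_distrib_left mult.commute
             del: integral_map_pmf)
  also have "(\<Sum>p\<in>A. measure_pmf.expectation (map_pmf ((#) p) (?perm (A - {p}))) ?swaps) =
      (\<Sum>p\<in>A. real (card {x \<in> A. x < p})
             + measure_pmf.expectation (swaps_pmf {x \<in> A. x < p}) real
             + measure_pmf.expectation (swaps_pmf {x \<in> A. p < x}) real)"
    by (intro sum.cong refl pivot)
  finally show ?thesis .
qed

lemma expectation_swaps:
  fixes A :: "'a :: linorder set"
  assumes "finite A"
  shows "measure_pmf.expectation (swaps_pmf A) real = mean_swaps (card A)"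
  using assms
proof (induction A rule: finite_psubset_induct)
  case (psubset A)
  show ?case
  proof (cases "A = {}")
    case True
    then show ?thesis
      by (simp add: swaps_pmf_def mean_swaps_def H_def pmf_of_set_singleton)
  next
    case False
    let ?n = "card A" and ?rank = "\<lambda>p. card {x \<in> A. x < p}"
    have IH: "measure_pmf.expectation (swaps_pmf {x \<in> A. x < p}) real = mean_swaps (?rank p)"
      "measure_pmf.expectation (swaps_pmf {x \<in> A. p < x}) real = mean_swaps (?n - 1 - ?rank p)"
      if "p \<in> A" for p
    proof -
      have "{x \<in> A. x < p} \<subset> A" "{x \<in> A. p < x} \<subset> A"
        using that by auto
      then show "measure_pmf.expectation (swaps_pmf {x \<in> A. x < p}) real = mean_swaps (?rank p)"
        "measure_pmf.expectation (swaps_pmf {x \<in> A. p < x}) real = mean_swaps (?n - 1 - ?rank p)"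
        using psubset.IH card_greater[OF psubset.hyps that] by simp_all
    qed
    have "measure_pmf.expectation (swaps_pmf A) real =
        (\<Sum>p\<in>A. real (?rank p) + mean_swaps (?rank p) + mean_swaps (?n - 1 - ?rank p)) / real ?n"
      unfolding expectation_swaps_rec[OF psubset.hyps False]
      by (intro arg_cong2[where f = "(/)"] sum.cong refl) (simp only: IH)
    also have "(\<Sum>p\<in>A. real (?rank p) + mean_swaps (?rank p) + mean_swaps (?n - 1 - ?rank p)) =
        (\<Sum>k<?n. real k + mean_swaps k + mean_swaps (?n - 1 - k))"
      by (rule sum.reindex_bij_betw[OF bij_betw_card_less[OF psubset.hyps]])
    also have "\<dots> = real ?n * mean_swaps ?n"
      by (rule mean_swaps_rec)
    finally show ?thesis
      using psubset.hyps False by simp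
  qed
qed

theorem theorem4p5:
  fixes A :: "'a :: linorder set" and n :: nat
  assumes "n \<ge> 1" and "finite A" and "card A = n"
  shows "measure_pmf.expectation (swaps_pmf A) real = (real n + 1) * H 1 n - 2 * real n"
  using expectation_swaps[OF assms(2)] assms(3) by (simp add: mean_swaps_def)

end
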